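(* Let $L>0$, let $f:\mathbb{R}^d\to\mathbb{R}$ be a convex $L$-smooth function with a minimizer $\boldsymbol{x}^*\in\arg\min_{\boldsymbol{x}\in\mathbb{R}^d}f(\boldsymbol{x})$, let $\boldsymbol{x}_0\in\mathbb{R}^d$ be arbitrary, and let $K\ge1$. Define $\{A_k\}_{k=0}^K$ recursively by $A_K=1$ and $$A_k=A_{k+1}\Big[1+\tfrac12A_{k+1}-\tfrac12\sqrt{A_{k+1}(4+A_{k+1})}\Big],\qquad 0\le k\le K-1,$$ and $a_{k+1}=A_{k+1}-A_k$ for $0\le k\le K-1$. Let $\boldsymbol{v}_0=\boldsymbol{x}_0-\frac{A_1}{a_1L}\nabla f(\boldsymbol{x}_0)$, $\boldsymbol{g}_0=a_1\nabla f(\boldsymbol{x}_0)$, and for $k=1,\dots,K-1$ let $$\boldsymbol{y}_{k-1}=\boldsymbol{x}_{k-1}-\frac1L\nabla f(\boldsymbol{x}_{k-1}),$$ $$\boldsymbol{x}_k=\frac{A_k}{A_{k+1}}\boldsymbol{y}_{k-1}+\frac{a_{k+1}}{A_{k+1}}\boldsymbol{v}_{k-1}-\frac{1}{L\,a_{k+1}}\boldsymbol{g}_{k-1},$$ $$\boldsymbol{v}_k=\boldsymbol{v}_{k-1}-\frac1L\frac{A_{k+1}}{a_{k+1}}\nabla f(\boldsymbol{x}_k),\qquad \boldsymbol{g}_k=\boldsymbol{g}_{k-1}+a_{k+1}\nabla f(\boldsymbol{x}_k).$$ Let $\boldsymbol{y}_{K-1}=\boldsymbol{x}_{K-1}-\frac1L\nabla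 f(\boldsymbol{x}_{K-1})$ and $$\boldsymbol{x}_K=\boldsymbol{y}_{K-1}-\frac{1}{A_KL}\boldsymbol{g}_{K-1}.$$ Then $$\|\nabla f(\boldsymbol{x}_K)\|^2\le\frac{16L(f(\boldsymbol{x}_0)-f(\boldsymbol{x}^* ))}{(K+2)^2}.$$
   Context: $\|\cdot\| = \sqrt{\langle\cdot,\cdot\rangle}$ is the norm induced by an inner product on $\mathbb{R}^d$, and gradients are taken with respect to that inner product. $f$ is $L$-smooth if it is continuously differentiable and $\|\nabla f(\boldsymbol{x})-\nabla f(\boldsymbol{y})\|\le L\|\boldsymbol{x}-\boldsymbol{y}\|$ for all $\boldsymbol{x},\boldsymbol{y}$. *)

theory Defs
  imports "HOL-Analysis.Analysis"
begin

text \<open>The Riesz representative of the derivative with respect to the inner product of the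
  type; it is meaningful only at points where the function is differentiable.\<close>

definition grad :: "('a::real_inner \<Rightarrow> real) \<Rightarrow> 'a \<Rightarrow> 'a" where
  "grad f x = (THE D. GDERIV f x :> D)"

definition L_smooth :: "real \<Rightarrow> ('a::euclidean_space \<Rightarrow> real) \<Rightarrow> bool" where
  "L_smooth L f \<longleftrightarrow>
     (\<forall>x. f differentiable at x) \<and> continuous_on UNIV (grad f) \<and>
     (\<forall>x y. norm (grad f x - grad f y) \<le> L * norm (x - y))"

end

theory Submission
  imports Defs
begin

text \<open>
  Write \<open>G k\<close> for \<open>\<nabla>f (x k)\<close> and \<open>Y k = x k - G k / L\<close> for the result of a gradient step from
  \<open>x k\<close>.  The proof adds up weighted instances of one inequality, valid for all \<open>i\<close> and \<open>j\<close>
  because \<open>f\<close> is convex and \<open>L\<close>-smooth (\<open>convex_L_smooth_interpolation\<close>):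
  \<open>f (x i) \<ge> f (x j) + \<langle>G j, Y i - x j\<rangle> + (\<parallel>G i\<parallel>\<^sup>2 + \<parallel>G j\<parallel>\<^sup>2) / (2 L)\<close>.
  The pair \<open>(i, j) = (k, k + 1)\<close> gets the weight \<open>A (k + 1)\<close> and the pair \<open>(K, k)\<close> the weight
  \<open>a (k + 1) = A (k + 1) - A k\<close>, for \<open>k < K\<close>.  Move all function values to the left
  side.  With these weights they cancel except at \<open>x 0\<close> and \<open>x K\<close>, and what remains is
  \<open>A 0 (f (x 0) - f (x K))\<close>.

  The right side is a quadratic form in the gradients.  It can be evaluated because of two facts.
  The recursion for \<open>A\<close> solves the quadratic equation \<open>a (k + 1)\<^sup>2 = A (k + 1)\<^sup>2 A k\<close>.  As a
  consequence, the three sequences of the method are dependent: \<open>Y k - v k\<close> is the multiple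
  \<open>1 / (L A (k + 1)\<^sup>2)\<close> of \<open>g k\<close>, so that \<open>x (k + 1) - Y k\<close> is a multiple of \<open>g k\<close> too
  (\<open>momentum_identity_step\<close>).  Hence the partial sums of the weighted inequalities are closed
  expressions, in which the past enters only through \<open>g k\<close>, \<open>G k\<close> and \<open>G 0\<close>
  (\<open>potential_step\<close>).  At the end the rule for \<open>x K\<close> removes all the terms in \<open>g (K - 1)\<close>,
  leaving
  \<open>A 0 (f (x 0) - f (x K)) \<ge> ((1 - A 0 / 2) \<parallel>G K\<parallel>\<^sup>2 - (A 0 / 2) \<parallel>G 0\<parallel>\<^sup>2) / L\<close>.

  One gradient step from a point cannot go below the minimum, so
  \<open>\<parallel>G k\<parallel>\<^sup>2 \<le> 2 L (f (x k) - f xstar)\<close> (\<open>norm_grad_le_minimum_gap\<close>).  Applied at \<open>K\<close> and at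
  \<open>0\<close>, this turns the above into \<open>\<parallel>G K\<parallel>\<^sup>2 \<le> 2 L A 0 (f (x 0) - f xstar)\<close>.  Finally
  \<open>A 0 \<le> 4 / (K + 2)\<^sup>2\<close> (\<open>weight_bounds\<close>): the numbers \<open>1 / sqrt (A k)\<close> start from \<open>1\<close> at
  \<open>k = K\<close> and grow by at least \<open>1/2\<close> whenever \<open>k\<close> decreases by one.  This proves the bound with
  the constant \<open>8\<close> in place of \<open>16\<close>.
\<close>

section \<open>Convex functions with Lipschitz gradient\<close>

lemma GDERIV_grad:
  fixes f :: "'a::euclidean_space \<Rightarrow> real"
  assumes "f differentiable at x"
  shows "GDERIV f x :> grad f x"
proof -
  obtain D where D: "(f has_derivative D) (at x)"
    using assms by (auto simp: differentiable_def)
  have "linear D"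
    using D has_derivative_linear by blast
  then have "D = (\<lambda>h. inner h (adjoint D 1))"
    by (simp add: fun_eq_iff adjoint_works)
  with D have ex: "GDERIV f x :> adjoint D 1"
    by (simp add: gderiv_def)
  have uniq: "E = adjoint D 1" if "GDERIV f x :> E" for E
  proof -
    have "(\<lambda>h. inner h E) = (\<lambda>h. inner h (adjoint D 1))"
      by (rule has_derivative_unique[OF that[unfolded gderiv_def] ex[unfolded gderiv_def]])
    then have "\<forall>h. inner h E = inner h (adjoint D 1)"
      by (simp add: fun_eq_iff)
    then show ?thesis
      using vector_eq_ldot[of E "adjoint D 1"] by blast
  qed
  show ?thesis
    unfolding grad_def using ex uniq by (rule theI)
qed

text \<open>
  Restricting to a line reduces the two first-order inequalities below to statements about
  functions of one real variable.
\<close>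

lemma DERIV_along_line:
  fixes f :: "'a::euclidean_space \<Rightarrow> real"
  assumes "f differentiable at (x + t *\<^sub>R d)"
  shows "((\<lambda>t. f (x + t *\<^sub>R d)) has_real_derivative inner (grad f (x + t *\<^sub>R d)) d) (at t)"
proof -
  have "((\<lambda>t. x + t *\<^sub>R d) has_derivative (\<lambda>h. h *\<^sub>R d)) (at t)"
    by (auto intro!: derivative_eq_intros)
  moreover have "(f has_derivative (\<lambda>h. inner h (grad f (x + t *\<^sub>R d)))) (at (x + t *\<^sub>R d))"
    using GDERIV_grad[OF assms] by (simp add: gderiv_def)
  ultimately have "((\<lambda>t. f (x + t *\<^sub>R d)) has_derivative
      (\<lambda>h. inner (h *\<^sub>R d) (grad f (x + t *\<^sub>R d)))) (at t)"
    by (rule has_derivative_compose)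
  moreover have "(\<lambda>h. inner (h *\<^sub>R d) (grad f (x + t *\<^sub>R d))) =
      (*) (inner (grad f (x + t *\<^sub>R d)) d)"
    by (simp add: fun_eq_iff inner_commute)
  ultimately show ?thesis
    by (simp add: has_field_derivative_def)
qed

lemma convex_above_gradient_tangent:
  fixes f :: "'a::euclidean_space \<Rightarrow> real"
  assumes convex: "convex_on UNIV f" and diff: "f differentiable at z"
  shows "f z + inner (grad f z) (w - z) \<le> f w"
proof -
  define \<phi> where "\<phi> = (\<lambda>t. f (z + t *\<^sub>R (w - z)))"
  have "convex_on UNIV \<phi>"
  proof (rule convex_onI)
    fix t s r :: real
    assume t: "0 < t" "t < 1"
    have "z + ((1 - t) *\<^sub>R s + t *\<^sub>R r) *\<^sub>R (w - z) =
        (1 - t) *\<^sub>R (z + s *\<^sub>R (w - z)) + t *\<^sub>R (z + r *\<^sub>R (w - z))"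
      by (simp add: algebra_simps)
    then show "\<phi> ((1 - t) *\<^sub>R s + t *\<^sub>R r) \<le> (1 - t) * \<phi> s + t * \<phi> r"
      using convex_onD[OF convex, of t "z + s *\<^sub>R (w - z)" "z + r *\<^sub>R (w - z)"] t
      by (simp add: \<phi>_def)
  qed simp
  moreover have "(\<phi> has_real_derivative inner (grad f z) (w - z)) (at 0)"
    using DERIV_along_line[of f z 0 "w - z"] diff by (simp add: \<phi>_def)
  ultimately have "\<phi> 1 - \<phi> 0 \<ge> inner (grad f z) (w - z) * (1 - 0)"
    by (intro convex_on_imp_above_tangent[where A = UNIV]) auto
  then show ?thesis
    by (simp add: \<phi>_def)
qed

lemma L_smooth_quadratic_upper_bound:
  fixes f :: "'a::euclidean_space \<Rightarrow> real"
  assumes smooth: "L_smooth L f"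
  shows "f w \<le> f x + inner (grad f x) (w - x) + L / 2 * (norm (w - x))\<^sup>2"
proof -
  define d where "d = w - x"
  define \<psi> where "\<psi> = (\<lambda>t. f (x + t *\<^sub>R d) - t * inner (grad f x) d - L / 2 * t\<^sup>2 * (norm d)\<^sup>2)"
  have "\<psi> 1 \<le> \<psi> 0"
  proof (rule DERIV_nonpos_imp_nonincreasing[where f = \<psi>])
    fix t :: real
    assume t: "0 \<le> t" "t \<le> 1"
    let ?slope = "inner (grad f (x + t *\<^sub>R d)) d - inner (grad f x) d - L * t * (norm d)\<^sup>2"
    have "f differentiable at (x + t *\<^sub>R d)"
      using smooth by (simp add: L_smooth_def)
    note DERIV_along_line[OF this, derivative_intros]
    have "(\<psi> has_real_derivative ?slope) (at t)"
      unfolding \<psi>_def by (auto intro!: derivative_eq_intros)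
    moreover have "inner (grad f (x + t *\<^sub>R d) - grad f x) d \<le> L * t * (norm d)\<^sup>2"
    proof -
      have "inner (grad f (x + t *\<^sub>R d) - grad f x) d
          \<le> norm (grad f (x + t *\<^sub>R d) - grad f x) * norm d"
        by (rule norm_cauchy_schwarz)
      also have "\<dots> \<le> (L * norm (x + t *\<^sub>R d - x)) * norm d"
        using smooth by (intro mult_right_mono) (simp_all only: L_smooth_def norm_ge_zero)
      also have "\<dots> = L * t * (norm d)\<^sup>2"
        using t by (simp add: power2_eq_square)
      finally show ?thesis .
    qed
    ultimately show "\<exists>y. (\<psi> has_real_derivative y) (at t) \<and> y \<le> 0"
      by (auto simp: inner_diff_left)
  qed simp
  then show ?thesis
    by (simp add: \<psi>_def d_def)
qed

text \<open>
  Compare, at the point \<open>w = x - (\<nabla>f x - \<nabla>f z) / L\<close>, the lower bound on \<open>f\<close> by its tangent at \<open>z\<close>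
  with the upper bound by its quadratic model at \<open>x\<close>; this \<open>w\<close> minimises the upper bound minus
  the lower bound, so it is where comparing them tells most.  The usual form of the result is
  \<open>f x \<ge> f z + \<langle>\<nabla>f z, x - z\<rangle> + \<parallel>\<nabla>f x - \<nabla>f z\<parallel>\<^sup>2 / (2 L)\<close>.  Here the mixed term
  \<open>\<langle>\<nabla>f x, \<nabla>f z\<rangle>\<close> of the squared norm is absorbed by replacing \<open>x\<close> with the gradient step from
  \<open>x\<close>, which is the quantity that the method works with.
\<close>

lemma convex_L_smooth_interpolation:
  fixes f :: "'a::euclidean_space \<Rightarrow> real"
  assumes L: "L > 0" and convex: "convex_on UNIV f" and smooth: "L_smooth L f"
  shows "f x \<ge> f z + inner (grad f z) (x - (1 / L) *\<^sub>R grad f x - z)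
      + ((norm (grad f x))\<^sup>2 + (norm (grad f z))\<^sup>2) / (2 * L)"
proof -
  let ?G = "grad f x" and ?H = "grad f z"
  define w where "w = x - (1 / L) *\<^sub>R (?G - ?H)"
  have "f z + inner ?H (w - z) \<le> f w"
    using convex_above_gradient_tangent[OF convex] smooth by (simp add: L_smooth_def)
  also have "\<dots> \<le> f x + inner ?G (w - x) + L / 2 * (norm (w - x))\<^sup>2"
    by (rule L_smooth_quadratic_upper_bound[OF smooth])
  finally have "f x \<ge> f z + inner ?H (w - z) - inner ?G (w - x) - L / 2 * (norm (w - x))\<^sup>2"
    by simp
  moreover have "inner ?H (w - z) - inner ?G (w - x) - L / 2 * (norm (w - x))\<^sup>2 =
      inner ?H (x - (1 / L) *\<^sub>R ?G - z) + ((norm ?G)\<^sup>2 + (norm ?H)\<^sup>2) / (2 * L)"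
    using L unfolding w_def power2_norm_eq_inner
    by (simp add: algebra_simps inner_diff_left inner_diff_right inner_commute
        divide_simps power2_eq_square)
  ultimately show ?thesis
    by simp
qed

text \<open>By the quadratic upper bound, a gradient step decreases \<open>f\<close> by at least \<open>\<parallel>\<nabla>f x\<parallel>\<^sup>2 / (2 L)\<close>.\<close>

lemma norm_grad_le_minimum_gap:
  fixes f :: "'a::euclidean_space \<Rightarrow> real"
  assumes L: "L > 0" and smooth: "L_smooth L f" and min: "\<And>w. f xstar \<le> f w"
  shows "(norm (grad f x))\<^sup>2 \<le> 2 * L * (f x - f xstar)"
proof -
  have "f xstar \<le> f (x - (1 / L) *\<^sub>R grad f x)"
    by (rule min)
  also have "\<dots> \<le> f x - (norm (grad f x))\<^sup>2 / (2 * L)"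
    using L_smooth_quadratic_upper_bound[OF smooth, of "x - (1 / L) *\<^sub>R grad f x" x] L
    unfolding power2_norm_eq_inner by (simp add: field_simps)
  finally show ?thesis
    using L by (simp add: field_simps)
qed

section \<open>The weights\<close>

text \<open>
  In the lemmas on a single step, \<open>A\<close> stands for \<open>A (k + 1)\<close> and \<open>B\<close> for \<open>A k\<close>, so that \<open>A - B\<close> is
  \<open>a (k + 1)\<close>.  The recursion selects the root in \<open>(0, A)\<close> of the quadratic equation
  \<open>(A - B)\<^sup>2 = A\<^sup>2 B\<close> in \<open>B\<close>, and everything else about the weights follows from this equation.
\<close>

lemma weight_recursion:
  fixes A B :: real
  assumes A: "A > 0" and B: "B = A * (1 + 1/2 * A - 1/2 * sqrt (A * (4 + A)))"
  shows "0 < B" "B < A" "(A - B)\<^sup>2 = A\<^sup>2 * B"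
proof -
  define s where "s = sqrt (A * (4 + A))"
  have s2: "s\<^sup>2 = A * (4 + A)"
    using A by (simp add: s_def)
  have "s \<ge> 0"
    using A by (simp add: s_def)
  have "s < A + 2"
    using A s2 by (intro power2_less_imp_less[of s]) (auto simp: power2_eq_square algebra_simps)
  moreover have "A < s"
    using A s2 \<open>s \<ge> 0\<close> by (intro power2_less_imp_less[of A]) (auto simp: power2_eq_square algebra_simps)
  moreover have Bs: "B = A * (1 + 1/2 * A - 1/2 * s)"
    using B by (simp add: s_def)
  ultimately show "0 < B" "B < A"
    using A by auto
  have "(A - B)\<^sup>2 = A\<^sup>2 * ((s - A) / 2)\<^sup>2"
    unfolding Bs by (simp add: power2_eq_square algebra_simps)
  also have "((s - A) / 2)\<^sup>2 = (s\<^sup>2 - 2 * A * s + A\<^sup>2) / 4"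
    by (simp add: power2_eq_square algebra_simps)
  also have "\<dots> = B"
    unfolding s2 Bs by (simp add: power2_eq_square field_simps)
  finally show "(A - B)\<^sup>2 = A\<^sup>2 * B" .
qed

text \<open>
  In terms of \<open>p = 1 / sqrt A\<close> and \<open>q = 1 / sqrt B\<close> the quadratic equation reads
  \<open>q\<^sup>2 - q = p\<^sup>2\<close>, that is \<open>(q - 1/2)\<^sup>2 = p\<^sup>2 + 1/4\<close>, which forces
  \<open>q \<ge> p + 1/2\<close> because \<open>q (q - 1) > 0\<close> rules out \<open>q < 1/2\<close>.
\<close>

lemma weight_decay_step:
  fixes A B m :: real
  assumes pos: "0 < A" "0 < B" "B < A" and quad: "(A - B)\<^sup>2 = A\<^sup>2 * B"
    and m: "m > 0" and A: "A \<le> 4 / m\<^sup>2"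
  shows "B \<le> 4 / (m + 1)\<^sup>2"
proof -
  define p q where "p = 1 / sqrt A" and "q = 1 / sqrt B"
  have pq: "p > 0" "q > 0" "p\<^sup>2 = 1 / A" "q\<^sup>2 = 1 / B"
    using pos by (simp_all add: p_def q_def power_divide)
  have root: "A - B = A * sqrt B"
    using quad pos by (metis abs_of_pos diff_gt_0_iff_gt real_sqrt_abs real_sqrt_mult)
  have "q\<^sup>2 - q = p\<^sup>2"
  proof -
    have "q = q\<^sup>2 * sqrt B"
      using pos by (simp add: q_def power_divide real_div_sqrt field_simps)
    then have "q\<^sup>2 - q = (1 - sqrt B) / B"
      using pq by (simp add: diff_divide_distrib)
    also have "\<dots> = 1 / A"
      using root pos by (simp add: field_simps)
    finally show ?thesis
      using pq by simp
  qed
  have "m / 2 \<le> p"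
  proof (rule power2_le_imp_le)
    show "(m / 2)\<^sup>2 \<le> p\<^sup>2"
      unfolding pq(3) using A pos m by (simp add: field_simps)
  qed (use pq in simp)
  have "p + 1/2 \<le> q"
  proof (rule ccontr)
    assume "\<not> ?thesis"
    then have "(q - 1/2)\<^sup>2 \<le> p\<^sup>2" if "q \<ge> 1/2"
      using that pq by (intro power_mono) auto
    moreover have "(q - 1/2)\<^sup>2 = p\<^sup>2 + 1/4"
      using \<open>q\<^sup>2 - q = p\<^sup>2\<close> by (simp add: power2_eq_square algebra_simps)
    moreover have "q \<ge> 1/2"
    proof -
      have "q * (q - 1) > 0"
        using \<open>q\<^sup>2 - q = p\<^sup>2\<close> zero_less_power[OF pq(1), of 2]
        by (simp add: power2_eq_square algebra_simps)
      then show ?thesis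
        using pq by (simp add: zero_less_mult_iff)
    qed
    ultimately show False
      by simp
  qed
  with \<open>m / 2 \<le> p\<close> have "((m + 1) / 2)\<^sup>2 \<le> q\<^sup>2"
    using m by (intro power_mono) auto
  then show ?thesis
    unfolding pq(4) using m pos by (simp add: field_simps)
qed

lemma weight_identities:
  fixes A B :: real
  assumes pos: "0 < B" "B < A" and quad: "(A - B)\<^sup>2 = A\<^sup>2 * B"
  shows "(A - B) / A\<^sup>2 = B / (A - B)"
    and "(A + B) / ((A - B) * B) + 1 / A\<^sup>2 = 1 / B\<^sup>2"
proof -
  define a where "a = A - B"
  have a: "0 < a" and A: "0 < A" and q: "a\<^sup>2 = A\<^sup>2 * B"
    using pos quad by (simp_all add: a_def)
  show "(A - B) / A\<^sup>2 = B / (A - B)"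
    using q A a by (simp add: a_def[symmetric] field_simps power2_eq_square)
  have "1 / B\<^sup>2 - 1 / A\<^sup>2 = (A + B) * a / (A\<^sup>2 * B * B)"
    using A pos by (simp add: a_def field_simps power2_eq_square)
  also have "\<dots> = (A + B) / ((A - B) * B)"
    unfolding q[symmetric] using a by (simp add: a_def[symmetric] power2_eq_square)
  finally show "(A + B) / ((A - B) * B) + 1 / A\<^sup>2 = 1 / B\<^sup>2"
    by simp
qed

lemma weight_bounds:
  fixes A :: "nat \<Rightarrow> real"
  assumes AK: "A K = 1"
    and rec: "\<And>k. k < K \<Longrightarrow>
           A k = A (k+1) * (1 + 1/2 * A (k+1) - 1/2 * sqrt (A (k+1) * (4 + A (k+1))))"
    and k: "k \<le> K"
  shows "0 < A k \<and> A k \<le> 4 / (real (K - k) + 2)\<^sup>2"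
  using k
proof (induction rule: inc_induct)
  case base
  then show ?case
    using AK by simp
next
  case (step k)
  have w: "0 < A k" "A k < A (Suc k)" "(A (Suc k) - A k)\<^sup>2 = (A (Suc k))\<^sup>2 * A k"
    using weight_recursion[of "A (Suc k)" "A k"] rec[of k] step by auto
  have "A k \<le> 4 / ((real (K - Suc k) + 2) + 1)\<^sup>2"
    using weight_decay_step[of "A (Suc k)" "A k" "real (K - Suc k) + 2"] w step by auto
  moreover have "real (K - k) = real (K - Suc k) + 1"
    using step by (simp add: of_nat_diff)
  ultimately show ?case
    using w by (simp add: algebra_simps)
qed

section \<open>One step of the method\<close>

text \<open>
  This is the induction step for the partial sum of the weighted inequalities.  The assumption
  \<open>old\<close> is the sum up to the point \<open>x k\<close>, where \<open>P = Y K - Y k\<close>, \<open>n\<close> and \<open>nK\<close> are the squared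
  gradient norms at \<open>x k\<close> and \<open>x K\<close>, and \<open>F\<close> and \<open>FK\<close> the corresponding function values; the constant \<open>c\<close> is what the
  first step leaves over, a multiple of the squared gradient norm at \<open>x 0\<close>.  The value \<open>F'\<close> and the
  gradient \<open>G\<close> belong to \<open>x (k + 1) = Y k - (w / L) g\<close>.  The sum is continued by \<open>B\<close>
  times \<open>consecutive\<close> plus \<open>A - B\<close> times \<open>terminal\<close>, and the conclusion is \<open>old\<close> with \<open>k\<close> advanced
  by one.  No estimate is involved beyond the three assumptions: the quadratic terms in \<open>g\<close> and \<open>G\<close>
  match by the identities \<open>w1\<close>, \<open>w2\<close> and \<open>aa\<close> for their coefficients.

  In \<open>old\<close> the linear term \<open>\<langle>g, P\<rangle>\<close> remains because the inequalities of the pairs \<open>(K, j)\<close> refer to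
  the final point, which is not known at step \<open>k\<close>; it is the remainder of a summation by parts, as
  \<open>g\<close> is the sum of the \<open>a (j + 1) G j\<close>.
\<close>

lemma potential_step:
  fixes g G P :: "'a::real_inner" and A B :: real
  assumes L: "L > 0" and pos: "0 < B" "B < A" and quad: "(A - B)\<^sup>2 = A\<^sup>2 * B"
    and w: "w = (A + B) / ((A - B) * B)"
    and old: "A0 * F0 - B * F + (B - A0) * FK \<ge>
        inner g P + ((norm g)\<^sup>2 / B\<^sup>2 - B / 2 * n + (B - A0) / 2 * nK - c) / L"
    and consecutive: "F \<ge> F' + inner G ((w / L) *\<^sub>R g) + (n + (norm G)\<^sup>2) / (2 * L)"
    and terminal: "FK \<ge> F' + inner G (P + (w / L) *\<^sub>R g) + (nK + (norm G)\<^sup>2) / (2 * L)"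
  shows "A0 * F0 - A * F' + (A - A0) * FK \<ge>
      inner (g + (A - B) *\<^sub>R G) (P + (w / L) *\<^sub>R g + (1 / L) *\<^sub>R G)
      + ((norm (g + (A - B) *\<^sub>R G))\<^sup>2 / A\<^sup>2 - A / 2 * (norm G)\<^sup>2 + (A - A0) / 2 * nK - c) / L"
proof -
  define a where "a = A - B"
  have a: "0 < a" "A = a + B"
    using pos by (simp_all add: a_def)
  have A: "0 < A"
    using pos by simp
  have aa: "a\<^sup>2 / A\<^sup>2 = B"
    using quad A by (simp add: a_def)
  have w1: "w + 1 / A\<^sup>2 = 1 / B\<^sup>2"
    using weight_identities(2)[OF pos quad] by (simp add: w)
  have w2: "1 + a * w + 2 * a / A\<^sup>2 = A * w"
  proof -
    have "2 * a / A\<^sup>2 = 2 * (B / a)"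
      unfolding times_divide_eq_right[symmetric] a_def weight_identities(1)[OF pos quad] ..
    moreover have "B * w = 1 + 2 * (B / a)"
      using a pos w by (simp add: a_def[symmetric] field_simps)
    moreover have "A * w = a * w + B * w"
      unfolding a(2) by (rule distrib_right)
    ultimately show ?thesis
      by linarith
  qed
  define gg gG GG gP GP where "gg = inner g g" and "gG = inner g G" and "GG = inner G G"
    and "gP = inner g P" and "GP = inner G P"
  note ip = gg_def[symmetric] gG_def[symmetric] GG_def[symmetric] gP_def[symmetric] GP_def[symmetric]
  have sym: "inner G g = gG"
    by (simp add: gG_def inner_commute)
  have "B * F \<ge> B * (F' + (w / L) * gG + (n + GG) / (2 * L))"
    using consecutive pos by (intro mult_left_mono) (simp_all add: sym ip power2_norm_eq_inner)
  moreover have "a * FK \<ge> a * (F' + GP + (w / L) * gG + (nK + GG) / (2 * L))"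
    using terminal a by (intro mult_left_mono)
      (simp_all add: sym ip power2_norm_eq_inner inner_add_right)
  ultimately have "A0 * F0 - A * F' + (A - A0) * FK \<ge>
      gP + (gg / B\<^sup>2 - B / 2 * n + (B - A0) / 2 * nK - c) / L
      + B * ((w / L) * gG + (n + GG) / (2 * L))
      + a * (GP + (w / L) * gG + (nK + GG) / (2 * L))"
    using old unfolding a(2) by (simp add: algebra_simps ip power2_norm_eq_inner)
  also have "gP + (gg / B\<^sup>2 - B / 2 * n + (B - A0) / 2 * nK - c) / L
      + B * ((w / L) * gG + (n + GG) / (2 * L))
      + a * (GP + (w / L) * gG + (nK + GG) / (2 * L)) =
      gP + a * GP + (gg / B\<^sup>2 + A * w * gG + A / 2 * GG + (A - A0) / 2 * nK - c) / L"
    using L unfolding a(2) by (simp add: field_simps)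
  also have "\<dots> = gP + a * GP + ((w + 1 / A\<^sup>2) * gg + (1 + a * w + 2 * a / A\<^sup>2) * gG
      + (a + a\<^sup>2 / A\<^sup>2 - A / 2) * GG + (A - A0) / 2 * nK - c) / L"
    unfolding w1 w2 aa using a(2) by (simp add: field_simps)
  also have "\<dots> = inner (g + a *\<^sub>R G) (P + (w / L) *\<^sub>R g + (1 / L) *\<^sub>R G)
      + ((norm (g + a *\<^sub>R G))\<^sup>2 / A\<^sup>2 - A / 2 * (norm G)\<^sup>2 + (A - A0) / 2 * nK - c) / L"
    using L A unfolding power2_norm_eq_inner
    by (simp add: inner_add_left inner_add_right ip sym field_simps power2_eq_square)
  finally show ?thesis
    by (simp add: a_def)
qed

text \<open>
  Here \<open>yk\<close> is \<open>Y k\<close> and \<open>x'\<close> is \<open>x (k + 1)\<close>.  If \<open>yk - v\<close> is the multiple \<open>1 / (L B\<^sup>2)\<close> of \<open>g\<close>, then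
  in the convex combination of \<open>yk\<close> and \<open>v\<close> that defines \<open>x'\<close> only \<open>yk\<close> and a multiple of \<open>g\<close>
  survive.  The second claim is the same relation one step later, with \<open>A\<close> in place of \<open>B\<close> and with
  the updated \<open>g\<close> and \<open>v\<close>.
\<close>

lemma momentum_identity_step:
  fixes A B :: real and g G x' yk v :: "'a::real_vector"
  assumes pos: "0 < B" "B < A" and quad: "(A - B)\<^sup>2 = A\<^sup>2 * B"
    and x': "x' = (B / A) *\<^sub>R yk + ((A - B) / A) *\<^sub>R v - (1 / (L * (A - B))) *\<^sub>R g"
    and old: "v = yk - (1 / (L * B\<^sup>2)) *\<^sub>R g"
  shows "x' = yk - (((A + B) / ((A - B) * B)) / L) *\<^sub>R g" (is ?extrapolation)
    and "v - ((1 / L) * (A / (A - B))) *\<^sub>R G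
         = (x' - (1 / L) *\<^sub>R G) - (1 / (L * A\<^sup>2)) *\<^sub>R (g + (A - B) *\<^sub>R G)" (is ?momentum)
proof -
  define a where "a = A - B"
  have a: "0 < a" "A = a + B" and A: "0 < A"
    using pos by (simp_all add: a_def)
  have q: "a\<^sup>2 = A\<^sup>2 * B"
    using quad by (simp add: a_def)
  have c1: "(a / A) / B\<^sup>2 + 1 / a = (A + B) / (a * B)"
  proof -
    have "(a / A) / B\<^sup>2 = a\<^sup>2 / (a * A * B\<^sup>2)"
      using a by (simp add: power2_eq_square)
    also have "\<dots> = A / (a * B)"
      unfolding q using A pos by (simp add: power2_eq_square)
    finally have "(a / A) / B\<^sup>2 = A / (a * B)" .
    moreover have "1 / a = B / (a * B)"
      using pos by simp
    ultimately show ?thesis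
      by (simp add: add_divide_distrib)
  qed
  have c2: "(A + B) / (a * B) + 1 / A\<^sup>2 = 1 / B\<^sup>2"
    using weight_identities(2)[OF pos quad] by (simp add: a_def)
  have c3: "1 + a / A\<^sup>2 = A / a"
    using weight_identities(1)[OF pos quad] a by (simp add: a_def[symmetric] field_simps)
  have "x' = (B / A + a / A) *\<^sub>R yk - (((a / A) / B\<^sup>2 + 1 / a) / L) *\<^sub>R g"
    unfolding x' old a_def[symmetric]
    by (simp add: algebra_simps add_divide_distrib)
  moreover have "B / A + a / A = 1"
    using A by (simp add: a_def diff_divide_distrib)
  ultimately have x'': "x' = yk - (((A + B) / (a * B)) / L) *\<^sub>R g"
    unfolding c1 by simp
  then show ?extrapolation
    by (simp add: a_def)
  have "(x' - (1 / L) *\<^sub>R G) - (1 / (L * A\<^sup>2)) *\<^sub>R (g + a *\<^sub>R G)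
      = yk - (((A + B) / (a * B) + 1 / A\<^sup>2) / L) *\<^sub>R g - ((1 + a / A\<^sup>2) / L) *\<^sub>R G"
    unfolding x'' by (simp add: algebra_simps add_divide_distrib)
  also have "\<dots> = v - ((1 / L) * (A / a)) *\<^sub>R G"
    unfolding c2 c3 old by (simp add: algebra_simps)
  finally show ?momentum
    by (simp add: a_def)
qed

section \<open>The convergence rate\<close>

theorem theorem2p7:
  fixes L :: real and f :: "'a::euclidean_space \<Rightarrow> real"
    and xstar :: 'a and K :: nat
    and A a :: "nat \<Rightarrow> real" and x y v g :: "nat \<Rightarrow> 'a"
  assumes "L > 0"
    and "convex_on UNIV f"
    and "L_smooth L f"
    and "is_arg_min f (\<lambda>z. z \<in> UNIV) xstar"
    and "K \<ge> 1"
    and "A K = 1"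
    and "\<And>k. k < K \<Longrightarrow>
           A k = A (k+1) * (1 + 1/2 * A (k+1) - 1/2 * sqrt (A (k+1) * (4 + A (k+1))))"
    and "\<And>k. k < K \<Longrightarrow> a (k+1) = A (k+1) - A k"
    and "v 0 = x 0 - (A 1 / (a 1 * L)) *\<^sub>R grad f (x 0)"
    and "g 0 = a 1 *\<^sub>R grad f (x 0)"
    and "\<And>k. k \<in> {1..K-1} \<Longrightarrow>
           y (k-1) = x (k-1) - (1 / L) *\<^sub>R grad f (x (k-1))"
    and "\<And>k. k \<in> {1..K-1} \<Longrightarrow>
           x k = (A k / A (k+1)) *\<^sub>R y (k-1) + (a (k+1) / A (k+1)) *\<^sub>R v (k-1)
                 - (1 / (L * a (k+1))) *\<^sub>R g (k-1)"
    and "\<And>k. k \<in> {1..K-1} \<Longrightarrow>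
           v k = v (k-1) - ((1 / L) * (A (k+1) / a (k+1))) *\<^sub>R grad f (x k)"
    and "\<And>k. k \<in> {1..K-1} \<Longrightarrow> g k = g (k-1) + a (k+1) *\<^sub>R grad f (x k)"
    and "y (K-1) = x (K-1) - (1 / L) *\<^sub>R grad f (x (K-1))"
    and "x K = y (K-1) - (1 / (A K * L)) *\<^sub>R g (K-1)"
  shows "(norm (grad f (x K)))\<^sup>2 \<le> 16 * L * (f (x 0) - f xstar) / (real K + 2)\<^sup>2"
proof -
  note L = assms(1) and convex = assms(2) and smooth = assms(3) and K = assms(5)
    and AK = assms(6) and A_rec = assms(7)
  define G where "G = (\<lambda>k. grad f (x k))"
  define Y where "Y = (\<lambda>k. x k - (1 / L) *\<^sub>R G k)"
  have min: "f xstar \<le> f w" for w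
    using assms(4) by (simp add: is_arg_min_linorder)
  have A_pos: "0 < A k" if "k \<le> K" for k
    using weight_bounds[OF AK A_rec that] by simp
  have A_step: "A k < A (Suc k)" "(A (Suc k) - A k)\<^sup>2 = (A (Suc k))\<^sup>2 * A k" if "k < K" for k
    using weight_recursion[of "A (Suc k)" "A k"] A_pos[of "Suc k"] A_rec[OF that] that by auto
  have a_eq: "a (Suc k) = A (Suc k) - A k" if "k < K" for k
    using assms(8)[OF that] by simp
  have interp: "f (x i) \<ge> f (x j) + inner (G j) (Y i - x j)
      + ((norm (G i))\<^sup>2 + (norm (G j))\<^sup>2) / (2 * L)" for i j
    using convex_L_smooth_interpolation[OF L convex smooth, of "x j" "x i"]
    by (simp add: G_def Y_def)
  have v_step: "v (Suc k) = v k - ((1 / L) * (A (Suc (Suc k)) / (A (Suc (Suc k)) - A (Suc k)))) *\<^sub>R G (Suc k)"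
    and g_step: "g (Suc k) = g k + (A (Suc (Suc k)) - A (Suc k)) *\<^sub>R G (Suc k)"
    and x_step: "x (Suc k) = (A (Suc k) / A (Suc (Suc k))) *\<^sub>R Y k
        + ((A (Suc (Suc k)) - A (Suc k)) / A (Suc (Suc k))) *\<^sub>R v k
        - (1 / (L * (A (Suc (Suc k)) - A (Suc k)))) *\<^sub>R g k"
    if "Suc k < K" for k
    using that assms(11-14)[of "Suc k"] a_eq[of "Suc k"] by (auto simp: G_def Y_def)
  have x_last: "x K = Y (K - 1) - (1 / L) *\<^sub>R g (K - 1)"
    using assms(15,16) AK by (simp add: G_def Y_def)

  have A1: "0 < A 0" "0 < A 1" "A 0 < A 1" "(a 1)\<^sup>2 = (A 1)\<^sup>2 * A 0" "a 1 = A 1 - A 0" "0 < a 1"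
    using A_pos[of 0] A_pos[of 1] A_step[of 0] a_eq[of 0] K by auto
  have g0: "g 0 = a 1 *\<^sub>R G 0"
    using assms(10) by (simp add: G_def)
  have momentum: "v k = Y k - (1 / (L * (A (Suc k))\<^sup>2)) *\<^sub>R g k" if "k < K" for k
    using that
  proof (induction k)
    case 0
    have "a 1 / (A 1)\<^sup>2 = A 0 / a 1"
      using weight_identities(1)[of "A 0" "A 1"] A1 by simp
    moreover have "A 1 / a 1 = 1 + A 0 / a 1"
      using A1 by (simp add: field_simps)
    ultimately have "A 1 / a 1 / L = (1 + a 1 / (A 1)\<^sup>2) / L"
      by simp
    (* The step from x 0 to v 0 is longer than the one to Y 0 by the coefficient of G 0 in the
       required multiple of g 0. *)
    then have "A 1 / (a 1 * L) = 1 / L + 1 / (L * (A 1)\<^sup>2) * a 1"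
      by (simp add: add_divide_distrib mult.commute)
    then show ?case
      using assms(9) by (simp add: g0 Y_def G_def algebra_simps)
  next
    case (Suc k)
    have "v (Suc k) = (x (Suc k) - (1 / L) *\<^sub>R G (Suc k)) - (1 / (L * (A (Suc (Suc k)))\<^sup>2)) *\<^sub>R
        (g k + (A (Suc (Suc k)) - A (Suc k)) *\<^sub>R G (Suc k))"
      unfolding v_step[OF Suc.prems]
      by (rule momentum_identity_step(2)[OF _ _ _ x_step])
        (use Suc A_pos[of "Suc k"] A_step[of "Suc k"] in auto)
    then show ?case
      by (simp add: Y_def g_step[OF Suc.prems])
  qed
  have x_extrapolate: "x (Suc k) = Y k
      - (((A (Suc (Suc k)) + A (Suc k)) / ((A (Suc (Suc k)) - A (Suc k)) * A (Suc k))) / L) *\<^sub>R g k"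
    if "Suc k < K" for k
    by (rule momentum_identity_step(1)[OF _ _ _ x_step[OF that] momentum])
      (use that A_pos[of "Suc k"] A_step[of "Suc k"] in auto)

  (* The partial sum: the pairs (j, j + 1) with j < k and the pairs (K, j) with j \<le> k. *)
  have potential: "A 0 * f (x 0) - A (Suc k) * f (x k) + (A (Suc k) - A 0) * f (x K)
      \<ge> inner (g k) (Y K - Y k)
      + ((norm (g k))\<^sup>2 / (A (Suc k))\<^sup>2 - A (Suc k) / 2 * (norm (G k))\<^sup>2
         + (A (Suc k) - A 0) / 2 * (norm (G K))\<^sup>2 - A 0 / 2 * (norm (G 0))\<^sup>2) / L"
    if "k < K" for k
    using that
  proof (induction k)
    case 0
    define n where "n = (norm (G 0))\<^sup>2"
    have "a 1 * f (x K) \<ge> a 1 * (f (x 0) + inner (G 0) (Y K - x 0)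
        + ((norm (G K))\<^sup>2 + n) / (2 * L))"
      using interp[where j = 0 and i = K] A1 by (intro mult_left_mono) (auto simp: n_def)
    moreover have "inner (g 0) (Y K - Y 0) = a 1 * inner (G 0) (Y K - x 0) + a 1 * n / L"
      by (simp add: g0 Y_def n_def power2_norm_eq_inner algebra_simps)
    moreover have "(norm (g 0))\<^sup>2 / (A 1)\<^sup>2 = A 0 * n"
      using A1 by (simp add: g0 n_def power_mult_distrib)
    moreover have "a 1 * n / L + (A 0 * n - A 1 / 2 * n + (A 1 - A 0) / 2 * (norm (G K))\<^sup>2 - A 0 / 2 * n) / L
        = a 1 * (((norm (G K))\<^sup>2 + n) / (2 * L))"
      using L unfolding A1(5) by (simp add: field_simps)
    moreover have "A 0 * f (x 0) - A 1 * f (x 0) + (A 1 - A 0) * f (x K) = a 1 * f (x K) - a 1 * f (x 0)"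
      unfolding A1(5) by (simp add: algebra_simps)
    ultimately show ?case
      by (simp add: n_def[symmetric] distrib_left)
  next
    case (Suc k)
    let ?A = "A (Suc (Suc k))" and ?B = "A (Suc k)"
    let ?w = "(?A + ?B) / ((?A - ?B) * ?B)"
    note ext = x_extrapolate[OF Suc.prems]
    have YK: "Y K - x (Suc k) = Y K - Y k + (?w / L) *\<^sub>R g k"
      by (simp add: ext)
    have YK': "Y K - Y (Suc k) = Y K - Y k + (?w / L) *\<^sub>R g k + (1 / L) *\<^sub>R G (Suc k)"
    proof -
      have "Y K - Y (Suc k) = Y K - x (Suc k) + (1 / L) *\<^sub>R G (Suc k)"
        by (simp add: Y_def)
      then show ?thesis
        unfolding YK .
    qed
    have consecutive: "f (x k) \<ge> f (x (Suc k)) + inner (G (Suc k)) ((?w / L) *\<^sub>R g k)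
        + ((norm (G k))\<^sup>2 + (norm (G (Suc k)))\<^sup>2) / (2 * L)"
      using interp[where i = k and j = "Suc k"] by (simp add: ext)
    have terminal: "f (x K) \<ge> f (x (Suc k)) + inner (G (Suc k)) (Y K - Y k + (?w / L) *\<^sub>R g k)
        + ((norm (G K))\<^sup>2 + (norm (G (Suc k)))\<^sup>2) / (2 * L)"
      using interp[where i = K and j = "Suc k"] unfolding YK .
    have weights: "0 < ?B" "?B < ?A" "(?A - ?B)\<^sup>2 = ?A\<^sup>2 * ?B"
      using A_pos[of "Suc k"] A_step[of "Suc k"] Suc.prems by auto
    show ?case
      unfolding g_step[OF Suc.prems] YK'
      by (rule potential_step[OF L weights refl Suc.IH consecutive terminal]) (use Suc.prems in simp)
  qed

  define gg c n nK n0 where "gg = (norm (g (K - 1)))\<^sup>2" and "c = inner (G K) (g (K - 1))"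
    and "n = (norm (G (K - 1)))\<^sup>2" and "nK = (norm (G K))\<^sup>2" and "n0 = (norm (G 0))\<^sup>2"
  (* The pair (K - 1, K) has weight A K = 1 and completes the sum.  All terms in g (K - 1) cancel
     because x K - Y (K - 1) is exactly - g (K - 1) / L. *)
  have "f (x (K - 1)) \<ge> f (x K) + c / L + (n + nK) / (2 * L)"
    using interp[where i = "K - 1" and j = K] by (simp add: x_last c_def n_def nK_def)
  moreover have "A 0 * f (x 0) - f (x (K - 1)) + (1 - A 0) * f (x K) \<ge>
      - (gg + c) / L + (gg - n / 2 + (1 - A 0) / 2 * nK - A 0 / 2 * n0) / L"
  proof -
    have "Y K - Y (K - 1) = - (1 / L) *\<^sub>R (g (K - 1) + G K)"
      unfolding Y_def[THEN fun_cong, of K] x_last by (simp add: algebra_simps)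
    then have "inner (g (K - 1)) (Y K - Y (K - 1)) = - (gg + c) / L"
      by (simp add: inner_add_right inner_commute power2_norm_eq_inner add_divide_distrib
          diff_divide_distrib gg_def c_def)
    then show ?thesis
      using potential[of "K - 1"] K AK by (simp add: gg_def n_def nK_def n0_def)
  qed
  moreover have "c / L + (n + nK) / (2 * L)
      + (- (gg + c) / L + (gg - n / 2 + (1 - A 0) / 2 * nK - A 0 / 2 * n0) / L)
      = ((1 - A 0 / 2) * nK - A 0 / 2 * n0) / L"
    using L by (simp add: field_simps)
  ultimately have "((1 - A 0 / 2) * nK - A 0 / 2 * n0) / L \<le> A 0 * (f (x 0) - f (x K))"
    by (simp add: algebra_simps)
  then have main: "(1 - A 0 / 2) * nK - A 0 / 2 * n0 \<le> A 0 * L * (f (x 0) - f (x K))"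
    using L by (simp add: field_simps)
  have bound: "(norm (grad f w))\<^sup>2 \<le> 2 * L * (f w - f xstar)" for w
    by (rule norm_grad_le_minimum_gap[OF L smooth min])
  define \<Delta> where "\<Delta> = f (x 0) - f xstar"
  have "A 0 / 2 * nK \<le> A 0 / 2 * (2 * L * (f (x K) - f xstar))"
    "A 0 / 2 * n0 \<le> A 0 / 2 * (2 * L * (f (x 0) - f xstar))"
    using bound A1 by (auto simp only: G_def nK_def n0_def intro!: mult_left_mono)
  with main have "nK \<le> A 0 * (2 * L * \<Delta>)"
    by (simp add: \<Delta>_def algebra_simps)
  also have "\<dots> \<le> 4 / (real K + 2)\<^sup>2 * (2 * L * \<Delta>)"
    using weight_bounds[OF AK A_rec, of 0] L min
    by (intro mult_right_mono) (auto simp: \<Delta>_def)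
  also have "\<dots> \<le> 16 * L * \<Delta> / (real K + 2)\<^sup>2"
    using L min by (auto simp: \<Delta>_def intro!: divide_right_mono mult_right_mono)
  finally show ?thesis
    by (simp add: nK_def G_def \<Delta>_def)
qed

end
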